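(* Let $M=\{\operatorname{Re} w=F(\operatorname{Re} z,\operatorname{Re}\zeta)\}\subset\mathbb{C}^3$ be a tube hypersurface of class $\mathcal{C}^5$ (for example of class $\mathcal{C}^\infty$) belonging to the class $\mathfrak{C}_{2,1}$. If $M$ is (locally) biholomorphic to the model $\big\{\operatorname{Re} w=\frac{(\operatorname{Re} z)^2}{1-\operatorname{Re}\zeta}\big\}$, then $M$ is in fact real-analytic.
   Context: Coordinates on $\mathbb{C}^3$ are $(z,\zeta,w)$; write $x=\operatorname{Re} z$, $y=\operatorname{Re}\zeta$. The class $\mathfrak{C}_{2,1}$ consists of $2$-nondegenerate real hypersurfaces $M^5\subset\mathbb{C}^3$ of constant Levi rank $1$; for a tube graph $\operatorname{Re} w=F(x,y)$ this means that at every point $F_{xx}\neq0$ and $F_{xx}F_{xxy}-F_{xy}F_{xxx}\neq0$, while $F_{xx}F_{yy}-(F_{xy})^2\equiv0$. "Locally biholomorphic" means that every point of $M$ has a neighbourhood in $M$ mapped onto an open subset of the model by a biholomorphic map between open subsets of $\mathbb{C}^3$. *)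

theory Defs
  imports "HOL-Analysis.Analysis"
begin

(* Class C^k, intended for open S: for every i <= k all i-fold iterated directional derivatives
   exist and are continuous. *)
fun Ck_on :: "nat \<Rightarrow> ('a::euclidean_space \<Rightarrow> 'b::real_normed_vector) \<Rightarrow> 'a set \<Rightarrow> bool" where
  "Ck_on 0 f S \<longleftrightarrow> continuous_on S f"
| "Ck_on (Suc k) f S \<longleftrightarrow>
     (\<forall>p\<in>S. f differentiable (at p)) \<and> (\<forall>v. Ck_on k (\<lambda>p. frechet_derivative f (at p) v) S)"

(* Near each point p the function is the sum of a multivariate power series in x - p.
   Multi-indices are the functions Basis \<rightarrow> nat (extensional outside Basis); has_sum is
   unconditional, hence absolute, summation. *)
definition real_analytic_on :: "('a::euclidean_space \<Rightarrow> real) \<Rightarrow> 'a set \<Rightarrow> bool" where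
  "real_analytic_on f S \<longleftrightarrow>
     (\<forall>p\<in>S. \<exists>a :: ('a \<Rightarrow> nat) \<Rightarrow> real. \<exists>\<epsilon>>0. \<forall>x\<in>ball p \<epsilon>.
        ((\<lambda>\<alpha>. a \<alpha> * (\<Prod>b\<in>Basis. ((x - p) \<bullet> b) ^ \<alpha> b)) has_sum f x) (Basis \<rightarrow>\<^sub>E UNIV))"

definition real_analytic_hypersurface :: "'a::euclidean_space set \<Rightarrow> bool" where
  "real_analytic_hypersurface M \<longleftrightarrow>
     (\<forall>p\<in>M. \<exists>U r. open U \<and> p \<in> U \<and> real_analytic_on r U \<and>
        (\<forall>q\<in>U. \<exists>v. frechet_derivative r (at q) v \<noteq> 0) \<and>
        M \<inter> U = {q \<in> U. r q = 0})"

(* Several complex variables: complex-linear Frechet derivative at every point; S is meant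
   to be open. *)
definition holomorphic_map_on :: "(complex^'n \<Rightarrow> complex^'m) \<Rightarrow> (complex^'n) set \<Rightarrow> bool" where
  "holomorphic_map_on f S \<longleftrightarrow>
     (\<forall>p\<in>S. \<exists>f'. (f has_derivative f') (at p) \<and> (\<forall>c v. f' (c *s v) = c *s f' v))"

definition biholomorphic_between ::
    "(complex^'n) set \<Rightarrow> (complex^'n) set \<Rightarrow> (complex^'n \<Rightarrow> complex^'n) \<Rightarrow> bool" where
  "biholomorphic_between U V \<phi> \<longleftrightarrow>
     open U \<and> open V \<and> bij_betw \<phi> U V \<and>
     holomorphic_map_on \<phi> U \<and> holomorphic_map_on (the_inv_into U \<phi>) V"

definition locally_biholomorphic :: "(complex^'n) set \<Rightarrow> (complex^'n) set \<Rightarrow> bool" where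
  "locally_biholomorphic M M' \<longleftrightarrow>
     (\<forall>p\<in>M. \<exists>N U V \<phi>. openin (top_of_set M) N \<and> p \<in> N \<and> N \<subseteq> U \<and>
        biholomorphic_between U V \<phi> \<and> openin (top_of_set M') (\<phi> ` N))"

(* The coordinates (z, \<zeta>, w) of a point p are p$1, p$2, p$3; the imaginary parts are free. *)
definition tube_graph :: "(real \<times> real) set \<Rightarrow> (real \<Rightarrow> real \<Rightarrow> real) \<Rightarrow> (complex^3) set" where
  "tube_graph D F = {p. (Re (p$1), Re (p$2)) \<in> D \<and> Re (p$3) = F (Re (p$1)) (Re (p$2))}"

definition pdx :: "(real \<Rightarrow> real \<Rightarrow> real) \<Rightarrow> real \<Rightarrow> real \<Rightarrow> real" where
  "pdx F x y = deriv (\<lambda>s. F s y) x"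

definition pdy :: "(real \<Rightarrow> real \<Rightarrow> real) \<Rightarrow> real \<Rightarrow> real \<Rightarrow> real" where
  "pdy F x y = deriv (\<lambda>t. F x t) y"

(* Membership of the tube graph of F in the class C_{2,1}: Levi rank one (F_xx nonzero and
   vanishing Hessian determinant) and 2-nondegeneracy. *)
definition class_C21 :: "(real \<times> real) set \<Rightarrow> (real \<Rightarrow> real \<Rightarrow> real) \<Rightarrow> bool" where
  "class_C21 D F \<longleftrightarrow>
     (\<forall>(x, y)\<in>D.
        pdx (pdx F) x y \<noteq> 0 \<and>
        pdx (pdx F) x y * pdy (pdx (pdx F)) x y - pdy (pdx F) x y * pdx (pdx (pdx F)) x y \<noteq> 0 \<and>
        pdx (pdx F) x y * pdy (pdy F) x y - (pdy (pdx F) x y)\<^sup>2 = 0)"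

(* The natural domain y \<noteq> 1 has to be imposed since x / 0 = 0. *)
definition model :: "(complex^3) set" where
  "model = tube_graph {(x, y). y \<noteq> 1} (\<lambda>x y. x\<^sup>2 / (1 - y))"

end

theory Submission
  imports Defs "HOL-Complex_Analysis.Cauchy_Integral_Formula"
begin

text \<open>Near each of its points the hypersurface is the zero set of \<open>\<rho> \<circ> \<phi>\<close>, where \<open>\<phi>\<close> is the
  biholomorphism and \<open>\<rho> = Re w * (1 - Re \<zeta>) - (Re z)\<^sup>2\<close> is a polynomial defining function of the
  model; its differential does not vanish because \<open>\<partial>\<rho> / \<partial>(Re w) = 1 - Re \<zeta>\<close> and \<open>d\<phi>\<close> is invertible.
  Analyticity of \<open>\<rho> \<circ> \<phi>\<close> follows by complexifying the real coordinates: a bounded separately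
  holomorphic function on a polydisc has a convergent power series, by induction on the number of
  variables, since Taylor coefficients in one variable depend holomorphically on the others.\<close>

section \<open>Taylor coefficients of bounded holomorphic functions: Cauchy bounds and dependence on
  a parameter\<close>

text \<open>Cauchy's inequality needs continuity up to the boundary circle, so it is applied on
  radii \<open>s < r\<close>, and then \<open>s\<close> tends to \<open>r\<close>. Reaching
  \<open>r\<close> itself lets the induction over the variables keep one radius throughout.\<close>

lemma bounded_holomorphic_taylor_coeff_bound:
  fixes f :: "complex \<Rightarrow> complex"
  assumes hol: "f holomorphic_on ball 0 r" and r: "0 < r"
    and bd: "\<And>t. t \<in> ball 0 r \<Longrightarrow> norm (f t) \<le> M"
  shows "norm ((deriv ^^ k) f 0 / fact k) \<le> M / r ^ k"
proof -
  have *: "norm ((deriv ^^ k) f 0 / fact k) \<le> M / s ^ k" if s: "0 < s" "s < r" for s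
  proof -
    have "norm ((deriv ^^ k) f 0) \<le> fact k * M / s ^ k"
    proof (rule Cauchy_inequality)
      show "f holomorphic_on ball 0 s"
        using hol s by (auto intro: holomorphic_on_subset)
      show "continuous_on (cball 0 s) f"
        using hol s by (intro holomorphic_on_imp_continuous_on) (auto intro: holomorphic_on_subset)
    qed (use s bd in auto)
    then show ?thesis
      by (simp add: norm_divide field_simps)
  qed
  have "((\<lambda>s. M / s ^ k) \<longlongrightarrow> M / r ^ k) (at_left r)"
    using r by (auto intro!: tendsto_eq_intros)
  moreover have "\<forall>\<^sub>F s in at_left r. norm ((deriv ^^ k) f 0 / fact k) \<le> M / s ^ k"
    using eventually_at_left_real[OF r] by eventually_elim (use * in auto)
  ultimately show ?thesis
    using tendsto_lowerbound by (metis trivial_limit_at_left_real)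
qed

text \<open>The k-th coefficient is the locally uniform limit of
  \<open>(h s t - (\<Sum>m<k. c m s * t ^ m)) / t ^ k\<close> as \<open>t\<close> tends to \<open>0\<close>.\<close>
lemma taylor_coeff_holomorphic_in_parameter:
  fixes h :: "complex \<Rightarrow> complex \<Rightarrow> complex"
  assumes S: "open S" and r: "0 < r"
    and hol1: "\<And>s. s \<in> S \<Longrightarrow> h s holomorphic_on ball 0 r"
    and hol2: "\<And>t. t \<in> ball 0 r \<Longrightarrow> (\<lambda>s. h s t) holomorphic_on S"
    and bd: "\<And>s t. s \<in> S \<Longrightarrow> t \<in> ball 0 r \<Longrightarrow> norm (h s t) \<le> M"
  shows "(\<lambda>s. (deriv ^^ k) (h s) 0 / fact k) holomorphic_on S"
proof (induction k rule: less_induct)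
  case (less k)
  define c where "c = (\<lambda>m s. (deriv ^^ m) (h s) 0 / fact m)"
  \<comment> \<open>These points tend to \<open>0\<close> in the punctured open disc. The shift by 2
    keeps the ratio \<open>norm (t n) / r = 1 / (n + 2)\<close> below 1 even for
    \<open>n = 0\<close>, and the geometric tail below then sums to
    \<open>1 / (n + 1)\<close>.\<close>
  define t :: "nat \<Rightarrow> complex" where "t = (\<lambda>n. of_real (r / (real n + 2)))"
  \<comment> \<open>The subtracted coefficients are holomorphic in \<open>s\<close> by strong
    induction, hence so is each \<open>g n\<close>.\<close>
  define g where "g = (\<lambda>n s. (h s (t n) - (\<Sum>m<k. c m s * t n ^ m)) / t n ^ k)"
  have nt: "norm (t n) = r / (real n + 2)" for n
    using r by (simp add: t_def norm_divide del: of_real_divide)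
  have t: "t n \<in> ball 0 r" "t n \<noteq> 0" for n
  proof -
    have "r / (real n + 2) < r / 1"
      using r by (intro divide_strict_left_mono) auto
    then show "t n \<in> ball 0 r"
      by (simp add: nt)
    have "norm (t n) \<noteq> 0"
      using r by (simp add: nt)
    then show "t n \<noteq> 0"
      by simp
  qed
  have cb: "norm (c m s) \<le> M / r ^ m" if "s \<in> S" for m s
    unfolding c_def
    by (rule bounded_holomorphic_taylor_coeff_bound[OF hol1[OF that] r bd[OF that]])
  \<comment> \<open>The error is the Taylor tail from order \<open>Suc k\<close> on, divided by
    \<open>t n ^ k\<close>. The Cauchy bounds have the same \<open>M\<close> for every
    \<open>s\<close>, which makes the estimate uniform on \<open>S\<close>.\<close>
  have err: "norm (g n s - c k s) \<le> M / r ^ k * inverse (real (Suc n))" if s: "s \<in> S" for n s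
  proof -
    have 1: "(\<lambda>m. c m s * t n ^ m) sums h s (t n)"
      using holomorphic_power_series[OF hol1[OF s] t(1)] by (simp add: c_def)
    have "(\<lambda>m. c (m + Suc k) s * t n ^ (m + Suc k)) sums (h s (t n) - (\<Sum>m<Suc k. c m s * t n ^ m))"
      by (rule sums_split_initial_segment[OF 1])
    then have "(\<lambda>m. c (m + Suc k) s * t n ^ (m + Suc k) / t n ^ k) sums
        ((h s (t n) - (\<Sum>m<Suc k. c m s * t n ^ m)) / t n ^ k)"
      by (rule sums_divide)
    moreover have "(h s (t n) - (\<Sum>m<Suc k. c m s * t n ^ m)) / t n ^ k = g n s - c k s"
      using t(2)[of n] by (simp add: g_def field_simps)
    moreover have "c (m + Suc k) s * t n ^ (m + Suc k) / t n ^ k = c (m + Suc k) s * t n ^ Suc m" for m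
      using t(2)[of n] by (simp add: power_add)
    ultimately have 2: "(\<lambda>m. c (m + Suc k) s * t n ^ Suc m) sums (g n s - c k s)"
      by simp
    have "(\<lambda>m. (1 / (real n + 2)) ^ m) sums (1 / (1 - 1 / (real n + 2)))"
      by (rule geometric_sums) simp
    then have 3: "(\<lambda>m. M / r ^ k * (1 / (real n + 2)) * (1 / (real n + 2)) ^ m) sums
       (M / r ^ k * (1 / (real n + 2)) * (1 / (1 - 1 / (real n + 2))))"
      by (rule sums_mult)
    have 4: "norm (c (m + Suc k) s * t n ^ Suc m) \<le> M / r ^ k * (1 / (real n + 2)) * (1 / (real n + 2)) ^ m" for m
    proof -
      have "norm (c (m + Suc k) s * t n ^ Suc m) \<le> M / r ^ (m + Suc k) * (r / (real n + 2)) ^ Suc m"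
        unfolding norm_mult norm_power nt using r by (intro mult_right_mono cb s) auto
      also have "\<dots> = M / r ^ k * (1 / (real n + 2)) * (1 / (real n + 2)) ^ m"
        using r by (simp add: power_add power_divide)
      finally show ?thesis .
    qed
    have "norm (g n s - c k s) \<le> M / r ^ k * (1 / (real n + 2)) * (1 / (1 - 1 / (real n + 2)))"
      using norm_suminf_le[OF 4 sums_summable[OF 3]] by (simp only: sums_unique[OF 2] sums_unique[OF 3])
    also have "\<dots> = M / r ^ k * (1 / (real n + 2) * (1 / (1 - 1 / (real n + 2))))"
      by (simp only: mult.assoc)
    also have "1 / (real n + 2) * (1 / (1 - 1 / (real n + 2))) = inverse (real (Suc n))"
      by (simp add: field_simps)
    finally show ?thesis .
  qed
  have "c k holomorphic_on S"
  proof (rule holomorphic_uniform_sequence[OF S])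
    show "g n holomorphic_on S" for n
      unfolding g_def
      by (intro holomorphic_intros hol2 t) (use less t in \<open>auto simp: c_def\<close>)
    have "uniform_limit S g (c k) sequentially"
      unfolding uniform_limit_iff
    proof (intro allI impI)
      fix e :: real assume "e > 0"
      have "(\<lambda>n. M / r ^ k * inverse (real (Suc n))) \<longlonglongrightarrow> M / r ^ k * 0"
        by (intro tendsto_mult tendsto_const LIMSEQ_inverse_real_of_nat)
      then have "\<forall>\<^sub>F n in sequentially. M / r ^ k * inverse (real (Suc n)) < e"
        using \<open>e > 0\<close> by (intro order_tendstoD) auto
      then show "\<forall>\<^sub>F n in sequentially. \<forall>s\<in>S. dist (g n s) (c k s) < e"
        by eventually_elim (auto simp: dist_norm intro: le_less_trans[OF err])
    qed
    then show "\<exists>d>0. cball s d \<subseteq> S \<and> uniform_limit (cball s d) g (c k) sequentially" if "s \<in> S" for s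
      using S that by (meson open_contains_cball uniform_limit_on_subset)
  qed
  then show ?case
    by (simp add: c_def)
qed

section \<open>Sums over multi-indices and the geometric series in several variables\<close>

text \<open>Used to turn sums over multi-indices on \<open>insert b B\<close> into iterated sums.
  Injectivity rests on extensionality: \<open>\<alpha>\<close> and \<open>\<beta>\<close> are both
  \<open>undefined\<close> at \<open>b\<close>, the one place where the update hides their
  values.\<close>

lemma PiE_insert_reindex:
  fixes b :: 'a
  assumes "b \<notin> B"
  shows "inj_on (\<lambda>(k::'c, \<alpha>). \<alpha>(b := k)) (UNIV \<times> (B \<rightarrow>\<^sub>E UNIV))"
    and "insert b B \<rightarrow>\<^sub>E UNIV = (\<lambda>(k, \<alpha>). \<alpha>(b := k)) ` (UNIV \<times> (B \<rightarrow>\<^sub>E UNIV))"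
proof -
  show "inj_on (\<lambda>(k::'c, \<alpha>). \<alpha>(b := k)) (UNIV \<times> (B \<rightarrow>\<^sub>E UNIV))"
  proof (rule inj_onI, clarify)
    fix k l :: 'c and \<alpha> \<beta> :: "'a \<Rightarrow> 'c"
    assume *: "\<alpha> \<in> B \<rightarrow>\<^sub>E UNIV" "\<beta> \<in> B \<rightarrow>\<^sub>E UNIV" "\<alpha>(b := k) = \<beta>(b := l)"
    have "\<alpha> x = \<beta> x" for x :: 'a
      using assms PiE_arb[OF *(1), of b] PiE_arb[OF *(2), of b] fun_cong[OF *(3), of x]
      by (cases "x = b") simp_all
    moreover have "k = l"
      using fun_cong[OF *(3), of b] by simp
    ultimately show "k = l \<and> \<alpha> = \<beta>"
      by auto
  qed
qed (rule PiE_insert_eq)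

lemma prod_power_upd_notin:
  assumes "b \<notin> B"
  shows "(\<Prod>i\<in>B. x i ^ (if i = b then k else \<alpha> i)) = (\<Prod>i\<in>B. x i ^ \<alpha> i)"
  using assms by (intro prod.cong) auto

text \<open>The majorant for power series on a polydisc. All terms are nonnegative, so summing first
  over the indices on \<open>B\<close> and then over the exponent of \<open>b\<close> yields the
  joint sum.\<close>

lemma has_sum_geometric_PiE:
  fixes x :: "'b \<Rightarrow> real"
  assumes "finite B" "\<And>b. b \<in> B \<Longrightarrow> 0 \<le> x b \<and> x b < 1"
  shows "((\<lambda>\<alpha>. \<Prod>b\<in>B. x b ^ \<alpha> b) has_sum (\<Prod>b\<in>B. 1 / (1 - x b))) (B \<rightarrow>\<^sub>E UNIV)"
  using assms
proof (induction B rule: finite_induct)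
  case empty
  then show ?case
    by (auto intro: has_sum_finiteI)
next
  case (insert b B)
  let ?h = "\<lambda>(k::nat, \<alpha>). \<alpha>(b := k)"
  let ?P = "\<Prod>b\<in>B. 1 / (1 - x b)"
  have IH: "((\<lambda>\<alpha>. \<Prod>b\<in>B. x b ^ \<alpha> b) has_sum ?P) (B \<rightarrow>\<^sub>E UNIV)"
    using insert by auto
  have xb: "0 \<le> x b" "x b < 1"
    using insert by auto
  have P: "0 \<le> ?P"
    using insert.prems by (intro prod_nonneg ballI) (simp add: less_imp_le)
  have inner: "((\<lambda>\<alpha>. x b ^ k * (\<Prod>b\<in>B. x b ^ \<alpha> b)) has_sum (x b ^ k * ?P)) (B \<rightarrow>\<^sub>E UNIV)" for k :: nat
    using IH by (rule has_sum_cmult_right)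
  have "(\<lambda>k. x b ^ k * ?P) sums (1 / (1 - x b) * ?P)"
    using xb by (intro sums_mult2 geometric_sums) auto
  then have outer: "((\<lambda>k. x b ^ k * ?P) has_sum (1 / (1 - x b) * ?P)) UNIV"
    using xb P by (intro sums_nonneg_imp_has_sum mult_nonneg_nonneg) auto
  have "((\<lambda>(k, \<alpha>). x b ^ k * (\<Prod>b\<in>B. x b ^ \<alpha> b)) has_sum (1 / (1 - x b) * ?P)) (UNIV \<times> (B \<rightarrow>\<^sub>E UNIV))"
  proof (rule has_sum_SigmaI)
    show "(\<lambda>(k, \<alpha>). x b ^ k * (\<Prod>b\<in>B. x b ^ \<alpha> b)) summable_on (UNIV \<times> (B \<rightarrow>\<^sub>E UNIV))"
    proof (rule summable_on_SigmaI[where g = "\<lambda>k. x b ^ k * ?P"])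
      show "(\<lambda>k. x b ^ k * ?P) summable_on UNIV"
        using outer by (rule has_sum_imp_summable)
    qed (use inner xb insert.prems in \<open>auto intro!: mult_nonneg_nonneg prod_nonneg\<close>)
  qed (use inner outer in auto)
  moreover have "(\<lambda>(k, \<alpha>). x b ^ k * (\<Prod>b\<in>B. x b ^ \<alpha> b)) = (\<lambda>\<alpha>. \<Prod>b\<in>insert b B. x b ^ \<alpha> b) \<circ> ?h"
    using insert.hyps by (simp add: fun_eq_iff prod_power_upd_notin)
  ultimately show ?case
    using insert.hyps
    by (simp add: PiE_insert_reindex(2) has_sum_reindex PiE_insert_reindex(1))
qed

section \<open>Power series of bounded, separately holomorphic functions on polydiscs\<close>

text \<open>With the value \<open>0\<close> off \<open>B\<close>, the polydisc over the empty set is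
  a single point, and for \<open>b\<close> outside \<open>B\<close> the polydisc over
  \<open>B\<close> is the slice \<open>z b = 0\<close> of the one over
  \<open>insert b B\<close>.\<close>

definition polydisc :: "'b set \<Rightarrow> real \<Rightarrow> ('b \<Rightarrow> complex) set" where
  "polydisc B r = {z. (\<forall>i\<in>B. norm (z i) < r) \<and> (\<forall>i. i \<notin> B \<longrightarrow> z i = 0)}"

text \<open>The coefficient bound belongs to the claim because the induction needs it: summability
  of each inner series alone would not make the joint series summable, whereas the bounds allow
  comparison with a geometric series.\<close>

lemma polydisc_power_series:
  fixes f :: "('b \<Rightarrow> complex) \<Rightarrow> complex"
  assumes "finite B" and r: "0 < r"
    and "\<And>z b. z \<in> polydisc B r \<Longrightarrow> b \<in> B \<Longrightarrow> (\<lambda>t. f (z(b := t))) holomorphic_on ball 0 r"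
    and "\<And>z. z \<in> polydisc B r \<Longrightarrow> norm (f z) \<le> M"
  shows "\<exists>a. (\<forall>\<alpha>\<in>B \<rightarrow>\<^sub>E UNIV. norm (a \<alpha>) \<le> M / r ^ (\<Sum>b\<in>B. \<alpha> b)) \<and>
    (\<forall>z\<in>polydisc B r. ((\<lambda>\<alpha>. a \<alpha> * (\<Prod>b\<in>B. z b ^ \<alpha> b)) has_sum f z) (B \<rightarrow>\<^sub>E UNIV))"
  using assms(1,3,4)
proof (induction B arbitrary: f M rule: finite_induct)
  case empty
  have *: "polydisc ({}::'b set) r = {\<lambda>_. 0}"
    by (auto simp: polydisc_def)
  then show ?case
    using empty by (intro exI[of _ "\<lambda>_. f (\<lambda>_. 0)"]) (auto simp: * intro: has_sum_finiteI)
next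
  case (insert b B)
  let ?h = "\<lambda>(k::nat, \<alpha>). \<alpha>(b := k)"
  define c where "c = (\<lambda>k z. (deriv ^^ k) (\<lambda>t. f (z(b := t))) 0 / fact k)"
  have upd: "z(b := t) \<in> polydisc (insert b B) r" if "z \<in> polydisc B r" "t \<in> ball 0 r" for z t
    using that by (auto simp: polydisc_def)
  have upd0: "z(b := 0) \<in> polydisc B r" if "z \<in> polydisc (insert b B) r" for z
    using that insert.hyps by (auto simp: polydisc_def)
  have upd': "z(i := s) \<in> polydisc B r" if "z \<in> polydisc B r" "i \<in> B" "s \<in> ball 0 r" for z i s
    using that by (auto simp: polydisc_def)
  have hol: "(\<lambda>t. f (z(b := t))) holomorphic_on ball 0 r" if "z \<in> polydisc B r" for z
    using insert.prems(1)[OF upd[OF that, of 0], of b] r by (simp del: fun_upd_apply)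
  have bd: "norm (f (z(b := t))) \<le> M" if "z \<in> polydisc B r" "t \<in> ball 0 r" for z t
    using insert.prems(2)[OF upd[OF that]] .
  \<comment> \<open>The induction hypothesis is applied to the Taylor coefficient \<open>c k\<close>
    in direction \<open>b\<close>, a function of the other variables, with the new bound
    \<open>M / r ^ k\<close>; hence the generalisation over \<open>f\<close> and
    \<open>M\<close>.\<close>
  have "\<exists>a. (\<forall>\<alpha>\<in>B \<rightarrow>\<^sub>E UNIV. norm (a \<alpha>) \<le> (M / r ^ k) / r ^ (\<Sum>b\<in>B. \<alpha> b)) \<and>
    (\<forall>z\<in>polydisc B r. ((\<lambda>\<alpha>. a \<alpha> * (\<Prod>b\<in>B. z b ^ \<alpha> b)) has_sum c k z) (B \<rightarrow>\<^sub>E UNIV))" for k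
  proof (rule insert.IH)
    show "norm (c k z) \<le> M / r ^ k" if "z \<in> polydisc B r" for z
      unfolding c_def by (rule bounded_holomorphic_taylor_coeff_bound[OF hol[OF that] r bd[OF that]])
    show "(\<lambda>s. c k (z(i := s))) holomorphic_on ball 0 r" if z: "z \<in> polydisc B r" and i: "i \<in> B" for z i
      unfolding c_def
    proof (rule taylor_coeff_holomorphic_in_parameter[where M = M])
      fix t :: complex assume t: "t \<in> ball 0 r"
      have "i \<noteq> b"
        using i insert.hyps by auto
      then show "(\<lambda>s. f (z(i := s, b := t))) holomorphic_on ball 0 r"
        using insert.prems(1)[OF upd[OF z t], of i] i
        by (simp add: fun_upd_twist[of i b] del: fun_upd_apply)
    qed (use hol bd upd' z i r in auto)
  qed
  then have "\<exists>a. \<forall>k. (\<forall>\<alpha>\<in>B \<rightarrow>\<^sub>E UNIV. norm (a k \<alpha>) \<le> (M / r ^ k) / r ^ (\<Sum>b\<in>B. \<alpha> b)) \<and>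
    (\<forall>z\<in>polydisc B r. ((\<lambda>\<alpha>. a k \<alpha> * (\<Prod>b\<in>B. z b ^ \<alpha> b)) has_sum c k z) (B \<rightarrow>\<^sub>E UNIV))"
    by (intro choice allI)
  then obtain a where a: "\<forall>k. (\<forall>\<alpha>\<in>B \<rightarrow>\<^sub>E UNIV. norm (a k \<alpha>) \<le> (M / r ^ k) / r ^ (\<Sum>b\<in>B. \<alpha> b)) \<and>
    (\<forall>z\<in>polydisc B r. ((\<lambda>\<alpha>. a k \<alpha> * (\<Prod>b\<in>B. z b ^ \<alpha> b)) has_sum c k z) (B \<rightarrow>\<^sub>E UNIV))" ..
  note a_bd = a[THEN spec, THEN conjunct1, THEN bspec]
    and a_sum = a[THEN spec, THEN conjunct2, THEN bspec]
  \<comment> \<open>Resetting \<open>b\<close> to \<open>undefined\<close> makes the multi-index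
    extensional on \<open>B\<close> again, so that it lies in the index set of
    \<open>a k\<close>.\<close>
  define A where "A = (\<lambda>\<alpha>. a (\<alpha> b) (\<alpha>(b := undefined)))"
  have A: "A (\<alpha>(b := k)) = a k \<alpha>" if "\<alpha> \<in> B \<rightarrow>\<^sub>E UNIV" for k \<alpha>
  proof -
    have "\<alpha>(b := undefined) = \<alpha>"
      using PiE_arb[OF that, of b] insert.hyps by (simp add: fun_upd_idem)
    then show ?thesis
      by (simp add: A_def)
  qed
  show ?case
  proof (intro exI[of _ A] conjI ballI)
    show A_bd: "norm (A \<alpha>) \<le> M / r ^ (\<Sum>b\<in>insert b B. \<alpha> b)" if \<alpha>: "\<alpha> \<in> insert b B \<rightarrow>\<^sub>E UNIV" for \<alpha>
    proof -
      obtain k \<beta> where \<beta>: "\<alpha> = \<beta>(b := k)" "\<beta> \<in> B \<rightarrow>\<^sub>E UNIV"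
        using \<alpha> unfolding PiE_insert_eq by auto
      have "(\<Sum>i\<in>B. (\<beta>(b := k)) i) = (\<Sum>i\<in>B. \<beta> i)"
        using insert.hyps by (intro sum.cong) auto
      then show ?thesis
        using a_bd[OF \<beta>(2), of k] insert.hyps by (simp add: \<beta> A power_add)
    qed
    fix z assume z: "z \<in> polydisc (insert b B) r"
    let ?z = "z(b := 0)"
    let ?F = "\<lambda>(k, \<alpha>). z b ^ k * (a k \<alpha> * (\<Prod>b\<in>B. z b ^ \<alpha> b))"
    let ?G = "\<lambda>\<alpha>. A \<alpha> * (\<Prod>b\<in>insert b B. z b ^ \<alpha> b)"
    have zz: "?z \<in> polydisc B r" and zb: "z b \<in> ball 0 r"
      using z upd0 by (auto simp: polydisc_def)
    have GF: "(?G \<circ> ?h) x = ?F x" if "x \<in> UNIV \<times> (B \<rightarrow>\<^sub>E UNIV)" for x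
      using that insert.hyps by (auto simp: A prod_power_upd_notin)
    \<comment> \<open>Absolute summability follows by comparison with \<open>M\<close> times the
      geometric series in the ratios \<open>norm (z i) / r\<close>, all below 1.\<close>
    have "(\<lambda>\<alpha>. norm (?G \<alpha>)) summable_on (insert b B \<rightarrow>\<^sub>E UNIV)"
    proof (rule Infinite_Sum.abs_summable_on_comparison_test')
      have "(\<lambda>\<alpha>. \<Prod>i\<in>insert b B. (norm (z i) / r) ^ \<alpha> i) summable_on (insert b B \<rightarrow>\<^sub>E UNIV)"
        using z r insert.hyps
        by (intro has_sum_imp_summable[OF has_sum_geometric_PiE]) (auto simp: polydisc_def)
      then show "(\<lambda>\<alpha>. M * (\<Prod>i\<in>insert b B. (norm (z i) / r) ^ \<alpha> i)) summable_on (insert b B \<rightarrow>\<^sub>E UNIV)"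
        by (rule summable_on_cmult_right)
      fix \<alpha> :: "'b \<Rightarrow> nat" assume \<alpha>: "\<alpha> \<in> insert b B \<rightarrow>\<^sub>E UNIV"
      have "norm (?G \<alpha>) \<le> M / r ^ (\<Sum>b\<in>insert b B. \<alpha> b) * (\<Prod>i\<in>insert b B. norm (z i) ^ \<alpha> i)"
        unfolding norm_mult prod_norm[symmetric] norm_power
        by (intro mult_right_mono A_bd \<alpha> prod_nonneg) auto
      also have "\<dots> = M * (\<Prod>i\<in>insert b B. (norm (z i) / r) ^ \<alpha> i)"
        by (simp add: power_divide prod_dividef power_sum)
      finally show "norm (?G \<alpha>) \<le> M * (\<Prod>i\<in>insert b B. (norm (z i) / r) ^ \<alpha> i)" .
    qed
    then have G_summable: "?G summable_on (insert b B \<rightarrow>\<^sub>E UNIV)"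
      by (rule abs_summable_summable)
    have "(?G \<circ> ?h) summable_on (UNIV \<times> (B \<rightarrow>\<^sub>E UNIV))"
      using G_summable insert.hyps
      by (simp add: PiE_insert_reindex(2) summable_on_reindex PiE_insert_reindex(1))
    then have F_summable: "?F summable_on (UNIV \<times> (B \<rightarrow>\<^sub>E UNIV))"
      using summable_on_cong[of "UNIV \<times> (B \<rightarrow>\<^sub>E UNIV)" "?G \<circ> ?h" ?F] GF by blast
    have prod_eq: "(\<Prod>i\<in>B. ?z i ^ \<alpha> i) = (\<Prod>i\<in>B. z i ^ \<alpha> i)" for \<alpha> :: "'b \<Rightarrow> nat"
      using insert.hyps by (intro prod.cong) auto
    have inner: "((\<lambda>\<alpha>. ?F (k, \<alpha>)) has_sum (z b ^ k * c k ?z)) (B \<rightarrow>\<^sub>E UNIV)" for k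
      using has_sum_cmult_right[OF a_sum[OF zz, of k], of "z b ^ k"] by (simp only: prod_eq prod.case)
    have "(\<lambda>k. z b ^ k * c k ?z) sums f z"
      using holomorphic_power_series[OF hol[OF zz] zb] by (simp add: c_def mult.commute)
    \<comment> \<open>The one-variable expansion only gives ordered convergence. Joint summability
      makes the outer sum unconditional, and uniqueness of limits identifies its value as
      \<open>f z\<close>.\<close>
    moreover have *: "((\<lambda>k. z b ^ k * c k ?z) has_sum infsum ?F (UNIV \<times> (B \<rightarrow>\<^sub>E UNIV))) UNIV"
      by (rule has_sum_SigmaD[OF has_sum_infsum[OF F_summable] inner])
    ultimately have "((\<lambda>k. z b ^ k * c k ?z) has_sum f z) UNIV"
      using sums_unique2[OF has_sum_imp_sums[OF *]] by simp
    then have "(?F has_sum f z) (UNIV \<times> (B \<rightarrow>\<^sub>E UNIV))"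
      using inner F_summable by (intro has_sum_SigmaI) auto
    then have "((?G \<circ> ?h) has_sum f z) (UNIV \<times> (B \<rightarrow>\<^sub>E UNIV))"
      using has_sum_cong[of "UNIV \<times> (B \<rightarrow>\<^sub>E UNIV)" "?G \<circ> ?h" ?F] GF by blast
    then show "(?G has_sum f z) (insert b B \<rightarrow>\<^sub>E UNIV)"
      using insert.hyps
      by (simp add: PiE_insert_reindex(2) has_sum_reindex PiE_insert_reindex(1))
  qed
qed

section \<open>From a bounded complexification to real analyticity\<close>

text \<open>\<open>G\<close> extends \<open>f\<close>, written in coordinates centred at
  \<open>p\<close>, to complex coordinates; its power series restricts to real points. The default
  \<open>0\<close> off \<open>Basis\<close> is the one built into \<open>polydisc\<close>.\<close>

lemma real_analytic_onI_complexification: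
  fixes f :: "'a::euclidean_space \<Rightarrow> real"
  assumes "\<And>p. p \<in> S \<Longrightarrow> \<exists>r>0. \<exists>M G.
    (\<forall>z\<in>polydisc Basis r. norm (G z) \<le> M \<and>
      (\<forall>b\<in>Basis. (\<lambda>t. G (z(b := t))) holomorphic_on ball 0 r)) \<and>
    (\<forall>x\<in>ball p r. G (\<lambda>b. if b \<in> Basis then of_real ((x - p) \<bullet> b) else 0) = of_real (f x))"
  shows "real_analytic_on f S"
  unfolding real_analytic_on_def
proof
  fix p assume "p \<in> S"
  from assms[OF this] obtain r M G where r: "r > 0" and
    GM: "\<forall>z\<in>polydisc Basis r. norm (G z) \<le> M \<and>
      (\<forall>b\<in>Basis. (\<lambda>t. G (z(b := t))) holomorphic_on ball 0 r)" and
    G: "\<forall>x\<in>ball p r. G (\<lambda>b. if b \<in> Basis then of_real ((x - p) \<bullet> b) else 0) = of_real (f x)"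
    by (elim exE conjE)
  have bd: "norm (G z) \<le> M" if "z \<in> polydisc Basis r" for z
    using bspec[OF GM that] ..
  have hol: "(\<lambda>t. G (z(b := t))) holomorphic_on ball 0 r" if "z \<in> polydisc Basis r" "b \<in> Basis" for z b
    using bspec[OF GM that(1)] that(2) by (elim conjE bspec)
  obtain a where a: "\<And>z. z \<in> polydisc Basis r \<Longrightarrow>
      ((\<lambda>\<alpha>. a \<alpha> * (\<Prod>b\<in>Basis. z b ^ \<alpha> b)) has_sum G z) (Basis \<rightarrow>\<^sub>E UNIV)"
    using polydisc_power_series[OF finite_Basis r hol bd] by blast
  show "\<exists>a. \<exists>\<epsilon>>0. \<forall>x\<in>ball p \<epsilon>.
      ((\<lambda>\<alpha>. a \<alpha> * (\<Prod>b\<in>Basis. ((x - p) \<bullet> b) ^ \<alpha> b)) has_sum f x) (Basis \<rightarrow>\<^sub>E UNIV)"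
  \<comment> \<open>The monomials are real at real points, so taking real parts of the expansion of
    \<open>G\<close> amounts to taking real parts of its coefficients.\<close>
  proof (intro exI[of _ "\<lambda>\<alpha>. Re (a \<alpha>)"] exI[of _ r] conjI r ballI)
    fix x assume x: "x \<in> ball p r"
    let ?z = "\<lambda>b. if b \<in> Basis then of_real ((x - p) \<bullet> b) else (0::complex)"
    have "\<bar>(x - p) \<bullet> b\<bar> < r" if "b \<in> Basis" for b
      using Basis_le_norm[OF that, of "x - p"] x by (simp add: dist_norm norm_minus_commute)
    then have "?z \<in> polydisc Basis r"
      by (auto simp: polydisc_def)
    from has_sum_Re[OF a[OF this]]
    have "((\<lambda>\<alpha>. Re (a \<alpha> * (\<Prod>b\<in>Basis. ?z b ^ \<alpha> b))) has_sum f x) (Basis \<rightarrow>\<^sub>E UNIV)"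
      using bspec[OF G x] by simp
    moreover have "Re (a \<alpha> * (\<Prod>b\<in>Basis. ?z b ^ \<alpha> b)) = Re (a \<alpha>) * (\<Prod>b\<in>Basis. ((x - p) \<bullet> b) ^ \<alpha> b)" for \<alpha>
    proof -
      have "(\<Prod>b\<in>Basis. ?z b ^ \<alpha> b) = of_real (\<Prod>b\<in>Basis. ((x - p) \<bullet> b) ^ \<alpha> b)"
        by (simp add: of_real_prod)
      then show ?thesis
        by (simp only: times_complex.sel Re_complex_of_real Im_complex_of_real mult_zero_right diff_zero)
    qed
    ultimately show "((\<lambda>\<alpha>. Re (a \<alpha>) * (\<Prod>b\<in>Basis. ((x - p) \<bullet> b) ^ \<alpha> b)) has_sum f x) (Basis \<rightarrow>\<^sub>E UNIV)"
      by (simp only:)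
  qed
qed

section \<open>The defining function of the model composed with a holomorphic map\<close>

lemma norm_vector_scalar_mult_complex: "norm (c *s (v :: complex^'n)) = norm c * norm v"
  by (simp add: norm_vec_def norm_mult L2_set_right_distrib)

text \<open>By complex linearity \<open>f' (h *s v) = h *s f' v\<close>, so the derivative along a
  complex line is multiplication by the number \<open>f' v $ k\<close>. This supplies separate
  holomorphy.\<close>

lemma holomorphic_map_on_line:
  fixes \<phi> :: "complex^'n \<Rightarrow> complex^'m"
  assumes hol: "holomorphic_map_on \<phi> U" and T: "\<And>t. t \<in> T \<Longrightarrow> p + t *s v \<in> U"
  shows "(\<lambda>t. \<phi> (p + t *s v) $ k) holomorphic_on T"
  unfolding holomorphic_on_def
proof
  fix t assume "t \<in> T"
  then obtain f' where f': "(\<phi> has_derivative f') (at (p + t *s v))"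
    and lin: "\<And>c w. f' (c *s w) = c *s f' w"
    using hol T unfolding holomorphic_map_on_def by meson
  have "linear (\<lambda>t. t *s v)"
    by (intro linearI) (auto simp: vector_sadd_rdistrib vec_eq_iff)
  then have "((\<lambda>t. p + t *s v) has_derivative (\<lambda>t. t *s v)) (at t)"
    using has_derivative_add[OF has_derivative_const bounded_linear_imp_has_derivative]
    by (fastforce simp: linear_conv_bounded_linear)
  from diff_chain_at[OF this f']
  have "((\<lambda>t. \<phi> (p + t *s v)) has_derivative (\<lambda>h. f' (h *s v))) (at t)"
    by (simp add: o_def)
  from bounded_linear.has_derivative[OF bounded_linear_vec_nth this, of k]
  have "((\<lambda>t. \<phi> (p + t *s v) $ k) has_derivative (\<lambda>h. f' v $ k * h)) (at t)"
    by (simp add: lin mult.commute)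
  then show "(\<lambda>t. \<phi> (p + t *s v) $ k) field_differentiable at t within T"
    unfolding field_differentiable_def has_field_derivative_def
    by (meson has_derivative_at_withinI)
qed

lemma holomorphic_map_on_imp_continuous_on:
  "holomorphic_map_on \<phi> U \<Longrightarrow> continuous_on U \<phi>"
  unfolding holomorphic_map_on_def
  by (meson continuous_at_imp_continuous_on has_derivative_continuous)

definition model_fun :: "complex^3 \<Rightarrow> real" where
  "model_fun q = Re (q$3) * (1 - Re (q$2)) - (Re (q$1))\<^sup>2"

text \<open>The inequation excludes the points with \<open>Re z = 0\<close> and
  \<open>Re \<zeta> = 1\<close>, where the polynomial vanishes for every \<open>w\<close>.\<close>

lemma model_iff: "q \<in> model \<longleftrightarrow> Re (q$2) \<noteq> 1 \<and> model_fun q = 0"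
  by (auto simp: model_def tube_graph_def model_fun_def field_simps)

text \<open>The real coordinates \<open>(q - p) \<bullet> b\<close> are replaced by complex variables \<open>z b\<close>; the
  conjugate of a component of \<open>\<phi>\<close> becomes holomorphic in \<open>z\<close> by conjugating \<open>z\<close> as well.\<close>
lemma real_analytic_on_model_fun_holomorphic:
  fixes \<phi> :: "complex^'n \<Rightarrow> complex^3"
  assumes U: "open U" and hol: "holomorphic_map_on \<phi> U"
  shows "real_analytic_on (\<lambda>q. model_fun (\<phi> q)) U"
proof (rule real_analytic_onI_complexification)
  fix p assume p: "p \<in> U"
  have "isCont \<phi> p"
    using holomorphic_map_on_imp_continuous_on[OF hol] U p by (simp add: continuous_on_eq_continuous_at)
  then obtain d where d: "d > 0" "\<And>q. dist q p < d \<Longrightarrow> dist (\<phi> q) (\<phi> p) < 1"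
    unfolding continuous_at_eps_delta by (metis zero_less_one)
  obtain e where e: "e > 0" "ball p e \<subseteq> U"
    using U p open_contains_ball by blast
  define C where "C = norm (\<phi> p) + 1"
  \<comment> \<open>The sum in \<open>E\<close> has \<open>DIM(complex^'n)\<close> terms of norm
    below \<open>r\<close>, so \<open>E z\<close> stays within \<open>min d e\<close> of
    \<open>p\<close>: inside \<open>U\<close>, and where \<open>\<phi>\<close> is bounded by
    \<open>C\<close>.\<close>
  define r where "r = min d e / DIM(complex^'n)"
  \<comment> \<open>There is one complex variable per real basis vector, acting by the complex
    scalar product \<open>*s\<close>. For real \<open>z\<close> this is the point with real
    coordinates \<open>z\<close> relative to \<open>p\<close>.\<close>
  define E where "E = (\<lambda>z :: complex^'n \<Rightarrow> complex. p + (\<Sum>b\<in>Basis. z b *s b))"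
  \<comment> \<open>Complexification of the real part of the \<open>k\<close>-th component: for real
    \<open>z\<close> the two summands are conjugate to each other.\<close>
  define P where "P = (\<lambda>k z. (\<phi> (E z) $ k + cnj (\<phi> (E (cnj \<circ> z)) $ k)) / 2)"
  have r: "r > 0"
    using d e by (simp add: r_def)
  have dist_E: "dist p (E z) < min d e" if "z \<in> polydisc Basis r" for z
  proof -
    have "norm (\<Sum>b\<in>Basis. z b *s (b :: complex^'n)) \<le> (\<Sum>b\<in>(Basis :: (complex^'n) set). norm (z b))"
      by (rule norm_sum[THEN order_trans]) (simp add: norm_vector_scalar_mult_complex)
    also have "\<dots> < (\<Sum>b\<in>(Basis :: (complex^'n) set). r)"
      using that by (intro sum_strict_mono) (auto simp: polydisc_def)
    also have "\<dots> = min d e"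
      by (simp add: r_def)
    finally show ?thesis
      by (simp add: E_def dist_norm)
  qed
  have EU: "E z \<in> U" if "z \<in> polydisc Basis r" for z
    using dist_E[OF that] e by auto
  have bd: "norm (\<phi> (E z) $ k) \<le> C" if "z \<in> polydisc Basis r" for z k
  proof -
    have "dist (\<phi> (E z)) (\<phi> p) < 1"
      using dist_E[OF that] by (intro d) (simp add: dist_commute)
    then have "norm (\<phi> (E z)) \<le> C"
      unfolding C_def by (smt (verit) dist_norm norm_triangle_sub)
    then show ?thesis
      using Finite_Cartesian_Product.norm_nth_le order_trans by blast
  qed
  have cnj: "cnj \<circ> z \<in> polydisc Basis r" if "z \<in> polydisc Basis r" for z :: "complex^'n \<Rightarrow> complex"
    using that by (auto simp: polydisc_def)
  have hol_E: "(\<lambda>t. \<phi> (E (z(b := t))) $ k) holomorphic_on ball 0 r"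
    if z: "z \<in> polydisc Basis r" and b: "b \<in> Basis" for z b k
  proof -
    have E_upd: "E (z(b := t)) = E (z(b := 0)) + t *s b" for t
      using b by (simp add: E_def sum.remove[of Basis b])
    have "z(b := t) \<in> polydisc Basis r" if "t \<in> ball 0 r" for t
      using z b that by (auto simp: polydisc_def)
    then have "(\<lambda>t. \<phi> (E (z(b := 0)) + t *s b) $ k) holomorphic_on ball 0 r"
      by (intro holomorphic_map_on_line[OF hol]) (metis EU E_upd)
    then show ?thesis
      by (simp only: E_upd[symmetric])
  qed
  have hol_P: "(\<lambda>t. P k (z(b := t))) holomorphic_on ball 0 r"
    if z: "z \<in> polydisc Basis r" and b: "b \<in> Basis" for z b k
  proof -
    \<comment> \<open>Conjugating both argument and value preserves holomorphy, and the disc is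
      invariant under \<open>cnj\<close>.\<close>
    have "(cnj \<circ> (\<lambda>t. \<phi> (E ((cnj \<circ> z)(b := t))) $ k) \<circ> cnj) holomorphic_on ball 0 r"
      using hol_E[OF cnj[OF z] b, of k]
      by (intro holomorphic_on_compose_cnj_cnj) (auto elim: holomorphic_on_subset)
    then have "(\<lambda>t. cnj (\<phi> (E (cnj \<circ> z(b := t))) $ k)) holomorphic_on ball 0 r"
      by (simp add: o_def fun_upd_comp if_distrib fun_upd_def)
    then show ?thesis
      unfolding P_def by (intro holomorphic_intros hol_E z b) auto
  qed
  have bd_P: "norm (P k z) \<le> C" if "z \<in> polydisc Basis r" for k z
    using bd[OF that, of k] bd[OF cnj[OF that], of k]
      norm_triangle_ineq[of "\<phi> (E z) $ k" "cnj (\<phi> (E (cnj \<circ> z)) $ k)"]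
    by (simp add: P_def)
  define G where "G = (\<lambda>z. P 3 z * (1 - P 2 z) - (P 1 z)\<^sup>2)"
  show "\<exists>r>0. \<exists>M G.
    (\<forall>z\<in>polydisc Basis r. norm (G z) \<le> M \<and>
      (\<forall>b\<in>Basis. (\<lambda>t. G (z(b := t))) holomorphic_on ball 0 r)) \<and>
    (\<forall>x\<in>ball p r. G (\<lambda>b. if b \<in> Basis then of_real ((x - p) \<bullet> b) else 0) = of_real (model_fun (\<phi> x)))"
  proof (rule exI[of _ r], intro conjI r exI[of _ "C * (1 + C) + C\<^sup>2"] exI[of _ G] ballI)
    fix z assume z: "z \<in> polydisc (Basis :: (complex^'n) set) r"
    have "norm (G z) \<le> norm (P 3 z) * norm (1 - P 2 z) + norm (P 1 z) ^ 2"
      unfolding G_def norm_mult[symmetric] norm_power[symmetric] by (rule norm_triangle_ineq4)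
    also have "\<dots> \<le> C * (1 + C) + C\<^sup>2"
    proof -
      have "norm (1 - P 2 z) \<le> 1 + C"
        using norm_triangle_ineq4[of 1 "P 2 z"] bd_P[OF z, of 2] by simp
      then show ?thesis
        using bd_P[OF z] by (intro add_mono mult_mono power_mono) (auto simp: C_def)
    qed
    finally show "norm (G z) \<le> C * (1 + C) + C\<^sup>2" .
    show "(\<lambda>t. G (z(b := t))) holomorphic_on ball 0 r" if "b \<in> Basis" for b
      unfolding G_def by (intro holomorphic_intros hol_P z that)
  next
    fix x assume "x \<in> ball p r"
    let ?z = "\<lambda>b. if b \<in> Basis then of_real ((x - p) \<bullet> b) else (0 :: complex)"
    have *: "of_real c *s v = c *\<^sub>R v" for c and v :: "complex^'n"
      by (simp add: vec_eq_iff scaleR_conv_of_real[where 'a = complex])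
    have "(\<Sum>b\<in>Basis. ?z b *s b) = (\<Sum>b\<in>Basis. ((x - p) \<bullet> b) *\<^sub>R b)"
      by (intro sum.cong) (simp_all only: * if_True)
    then have E: "E ?z = x"
      by (simp only: E_def euclidean_representation) simp
    have "cnj \<circ> ?z = ?z"
      by (auto simp: fun_eq_iff)
    then have P: "P k ?z = of_real (Re (\<phi> x $ k))" for k
      by (simp only: P_def E complex_add_cnj) simp
    show "G ?z = of_real (model_fun (\<phi> x))"
      by (simp only: G_def P model_fun_def) simp
  qed
qed

section \<open>Nonvanishing of the differential of the pulled-back defining function\<close>

lemma model_fun_has_derivative:
  "(model_fun has_derivative
     (\<lambda>v. Re (v$3) * (1 - Re (q$2)) - Re (q$3) * Re (v$2) - 2 * Re (q$1) * Re (v$1))) (at q)"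
proof -
  have "((\<lambda>q. Re (q$k)) has_derivative (\<lambda>v. Re (v$k))) (at q)" for q :: "complex^3" and k
    by (intro bounded_linear_imp_has_derivative bounded_linear_compose[OF bounded_linear_Re] bounded_linear_vec_nth)
  note [derivative_intros] = this
  show ?thesis
    unfolding model_fun_def by (auto intro!: derivative_eq_intros simp: algebra_simps)
qed

lemma model_fun_biholomorphic_nonsingular:
  assumes bih: "biholomorphic_between U V \<phi>" and q: "q \<in> U" and ne: "Re (\<phi> q $ 2) \<noteq> 1"
  shows "\<exists>v. frechet_derivative (\<lambda>q. model_fun (\<phi> q)) (at q) v \<noteq> 0"
proof -
  define \<psi> where "\<psi> = the_inv_into U \<phi>"
  have bij: "bij_betw \<phi> U V" and V: "open V"
    and hol: "holomorphic_map_on \<phi> U" "holomorphic_map_on \<psi> V"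
    using bih by (auto simp: biholomorphic_between_def \<psi>_def)
  have \<phi>q: "\<phi> q \<in> V" and \<psi>\<phi>: "\<psi> (\<phi> q) = q"
    using bij q by (auto simp: bij_betw_def \<psi>_def the_inv_into_f_f)
  obtain \<phi>' \<psi>' where \<phi>': "(\<phi> has_derivative \<phi>') (at q)" and \<psi>': "(\<psi> has_derivative \<psi>') (at (\<phi> q))"
    using hol q \<phi>q unfolding holomorphic_map_on_def by meson
  \<comment> \<open>Differentiating \<open>\<phi> \<circ> \<psi> = id\<close> on \<open>V\<close>
    shows that \<open>\<psi>'\<close> is a right inverse of \<open>\<phi>'\<close>.\<close>
  have "((\<phi> \<circ> \<psi>) has_derivative (\<phi>' \<circ> \<psi>')) (at (\<phi> q))"
    using \<phi>' by (intro diff_chain_at \<psi>') (simp add: \<psi>\<phi>)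
  then have "((\<lambda>x. x) has_derivative (\<phi>' \<circ> \<psi>')) (at (\<phi> q))"
    by (rule has_derivative_transform_within_open[OF _ V \<phi>q])
      (use bij in \<open>auto simp: \<psi>_def bij_betw_def f_the_inv_into_f\<close>)
  then have inv: "\<phi>' (\<psi>' v) = v" for v
    using has_derivative_unique[OF _ has_derivative_ident] by (metis comp_apply)
  have "((\<lambda>q. model_fun (\<phi> q)) has_derivative
     (\<lambda>v. Re (\<phi>' v$3) * (1 - Re (\<phi> q$2)) - Re (\<phi> q$3) * Re (\<phi>' v$2) - 2 * Re (\<phi> q$1) * Re (\<phi>' v$1))) (at q)"
    using diff_chain_at[OF \<phi>' model_fun_has_derivative] by (simp add: o_def)
  \<comment> \<open>The test vector is the one that \<open>\<phi>'\<close> sends to the direction of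
    \<open>Re w\<close>, in which \<open>model_fun\<close> is affine with slope
    \<open>1 - Re \<zeta>\<close>.\<close>
  then have "frechet_derivative (\<lambda>q. model_fun (\<phi> q)) (at q) (\<psi>' (axis 3 1)) = 1 - Re (\<phi> q $ 2)"
    by (simp add: frechet_derivative_at[symmetric] inv axis_def)
  with ne show ?thesis
    by (intro exI[of _ "\<psi>' (axis 3 1)"]) simp
qed

section \<open>Local analytic defining functions of the hypersurface\<close>

lemma locally_biholomorphic_model_imp_real_analytic:
  assumes "locally_biholomorphic M model"
  shows "real_analytic_hypersurface M"
  unfolding real_analytic_hypersurface_def
proof
  fix p assume p: "p \<in> M"
  with assms obtain N U V \<phi> where N: "openin (top_of_set M) N" "p \<in> N" "N \<subseteq> U"
    and bih: "biholomorphic_between U V \<phi>" and img: "openin (top_of_set model) (\<phi> ` N)"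
    unfolding locally_biholomorphic_def by meson
  obtain S where S: "open S" "N = M \<inter> S"
    using N by (auto simp: openin_open)
  obtain W where W: "open W" "\<phi> ` N = model \<inter> W"
    using img by (auto simp: openin_open)
  have U: "open U" and inj: "inj_on \<phi> U" and hol: "holomorphic_map_on \<phi> U"
    using bih by (auto simp: biholomorphic_between_def bij_betw_def)
  \<comment> \<open>Off \<open>Re \<zeta> = 1\<close> the zeros of \<open>model_fun\<close> are
    exactly the model points and its differential does not vanish.\<close>
  define W' where "W' = W \<inter> {q :: complex^3. Re (q$2) \<noteq> 1}"
  \<comment> \<open>\<open>S\<close> forces points of \<open>M\<close> into \<open>N\<close>,
    \<open>U\<close> gives injectivity of \<open>\<phi>\<close>, and \<open>W'\<close> forces zeros
    of \<open>model_fun\<close> into the image of \<open>N\<close>.\<close>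
  define O' where "O' = S \<inter> (U \<inter> \<phi> -` W')"
  have "open {q :: complex^3. Re (q$2) \<noteq> 1}"
    by (intro open_Collect_neq continuous_intros)
  then have "open O'"
    using W S U holomorphic_map_on_imp_continuous_on[OF hol] unfolding O'_def W'_def
    by (intro open_Int continuous_open_preimage)
  have mem: "q \<in> M \<longleftrightarrow> model_fun (\<phi> q) = 0" if "q \<in> O'" for q
  proof
    assume "q \<in> M"
    with that have "\<phi> q \<in> \<phi> ` N"
      by (auto simp: O'_def S)
    then show "model_fun (\<phi> q) = 0"
      by (simp add: W model_iff)
  next
    assume "model_fun (\<phi> q) = 0"
    with that have "\<phi> q \<in> \<phi> ` N"
      by (auto simp: O'_def W'_def W model_iff)
    \<comment> \<open>The value \<open>\<phi> q\<close> is also attained at some point of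
      \<open>N\<close>; injectivity on \<open>U\<close> makes that point \<open>q\<close>.\<close>
    with that inj N show "q \<in> M"
      by (auto simp: O'_def S inj_on_def)
  qed
  have "\<phi> p \<in> model \<inter> W"
    using N W by blast
  then have "p \<in> O'"
    using N S by (auto simp: O'_def W'_def model_iff)
  moreover have "real_analytic_on (\<lambda>q. model_fun (\<phi> q)) O'"
    using real_analytic_on_model_fun_holomorphic[OF U hol]
    by (auto simp: real_analytic_on_def O'_def)
  moreover have "\<exists>v. frechet_derivative (\<lambda>q. model_fun (\<phi> q)) (at q) v \<noteq> 0" if "q \<in> O'" for q
    using that by (intro model_fun_biholomorphic_nonsingular[OF bih]) (auto simp: O'_def W'_def)
  ultimately show "\<exists>U r. open U \<and> p \<in> U \<and> real_analytic_on r U \<and>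
        (\<forall>q\<in>U. \<exists>v. frechet_derivative r (at q) v \<noteq> 0) \<and> M \<inter> U = {q \<in> U. r q = 0}"
    using \<open>open O'\<close> mem by (intro exI[of _ O'] exI[of _ "\<lambda>q. model_fun (\<phi> q)"]) auto
qed

theorem proposition8p1:
  fixes D :: "(real \<times> real) set" and F :: "real \<Rightarrow> real \<Rightarrow> real"
  assumes "open D"
    and "Ck_on 5 (\<lambda>(x, y). F x y) D"
    and "class_C21 D F"
    and "locally_biholomorphic (tube_graph D F) model"
  shows "real_analytic_hypersurface (tube_graph D F)"
  using assms(4) by (rule locally_biholomorphic_model_imp_real_analytic)

end
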